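(* There are morphisms \[ \mathbf{Sets}\longrightarrow\mathbf{Quan}\longrightarrow\mathbf{Sets} \] of algebraic theories whose composition is the identity.
   Context: A rack $(R,\rhd)$ is a set $R$ with a binary operation $\rhd$ such that for every $x\in R$ the left multiplication $y\mapsto x\rhd y$ is bijective and $x\rhd(y\rhd z)=(x\rhd y)\rhd(x\rhd z)$ for all $y,z\in R$. A quandle is a rack with $x\rhd x=x$ for all $x$; morphisms are maps preserving $\rhd$. $\mathbf{Sets}$ and $\mathbf{Quan}$ denote both the algebraic (Lawvere) theories of sets and quandles and their categories of models. A morphism of algebraic theories $\mathbf{T}\to\mathbf{T}'$ is written in the direction of the left adjoint; it is the same as a ('forgetful', right-adjoint) functor from $\mathbf{T}'$-models to $\mathbf{T}$-models commuting with the underlying-set functors. *)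

theory Defs
  imports Main
begin

section \<open>Lawvere theories\<close>

text \<open>
  A Lawvere theory is a category with objects the natural numbers in which \<open>n\<close> is the
  \<open>n\<close>-th power of the object \<open>1\<close> through chosen projections; these chosen projections are the
  image of the structure functor from the opposite of the skeleton of finite sets.
  Arrows need not know their source and target, so composition is indexed:
  \<open>cmp T l m n f g\<close> is the composite of \<open>g : l \<rightarrow> m\<close> followed by \<open>f : m \<rightarrow> n\<close>.
\<close>

record 'a lawvere =
  arr :: "nat \<Rightarrow> nat \<Rightarrow> 'a set"
  ident :: "nat \<Rightarrow> 'a"
  cmp :: "nat \<Rightarrow> nat \<Rightarrow> nat \<Rightarrow> 'a \<Rightarrow> 'a \<Rightarrow> 'a"
  proj :: "nat \<Rightarrow> nat \<Rightarrow> 'a"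

locale lawvere_theory =
  fixes T :: "'a lawvere"
  assumes ident_arr: "ident T n \<in> arr T n n"
    and comp_arr: "\<lbrakk>f \<in> arr T m n; g \<in> arr T l m\<rbrakk> \<Longrightarrow> cmp T l m n f g \<in> arr T l n"
    and comp_ident_left: "f \<in> arr T m n \<Longrightarrow> cmp T m n n (ident T n) f = f"
    and comp_ident_right: "f \<in> arr T m n \<Longrightarrow> cmp T m m n f (ident T m) = f"
    and comp_assoc:
      "\<lbrakk>f \<in> arr T m n; g \<in> arr T l m; h \<in> arr T k l\<rbrakk> \<Longrightarrow>
         cmp T k l n (cmp T l m n f g) h = cmp T k m n f (cmp T k l m g h)"
    and proj_arr: "i < n \<Longrightarrow> proj T n i \<in> arr T n 1"
    and proj_one: "proj T 1 0 = ident T 1"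
    and power: "(\<And>i. i < n \<Longrightarrow> fs i \<in> arr T m 1) \<Longrightarrow>
         \<exists>!g. g \<in> arr T m n \<and> (\<forall>i<n. cmp T m n 1 (proj T n i) g = fs i)"

text \<open>
  A morphism of theories \<open>T \<rightarrow> T'\<close> is an identity-on-objects functor that preserves the chosen
  projections, hence the finite products. Precomposition with it turns \<open>T'\<close>-models into
  \<open>T\<close>-models, so the arrow points in the direction of the left adjoint.
\<close>

locale lawvere_morphism =
  source: lawvere_theory T + target: lawvere_theory T'
  for T :: "'a lawvere" and T' :: "'b lawvere" +
  fixes F :: "nat \<Rightarrow> nat \<Rightarrow> 'a \<Rightarrow> 'b"
  assumes map_arr: "f \<in> arr T m n \<Longrightarrow> F m n f \<in> arr T' m n"
    and map_ident: "F n n (ident T n) = ident T' n"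
    and map_comp: "\<lbrakk>f \<in> arr T m n; g \<in> arr T l m\<rbrakk> \<Longrightarrow>
          F l n (cmp T l m n f g) = cmp T' l m n (F m n f) (F l m g)"
    and map_proj: "i < n \<Longrightarrow> F n 1 (proj T n i) = proj T' n i"


section \<open>The theory of an equational presentation\<close>

datatype 'f trm = Var nat | Op 'f "'f trm list"

text \<open>Only the symbols in \<open>ops\<close> belong to the signature, so that it can be empty.\<close>

record 'f presentation =
  ops :: "'f set"
  arity :: "'f \<Rightarrow> nat"
  axs :: "('f trm \<times> 'f trm) set"

fun wf_trm :: "'f presentation \<Rightarrow> nat \<Rightarrow> 'f trm \<Rightarrow> bool" where
  "wf_trm P m (Var i) \<longleftrightarrow> i < m"
| "wf_trm P m (Op f ts) \<longleftrightarrow>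
     f \<in> ops P \<and> length ts = arity P f \<and> (\<forall>t \<in> set ts. wf_trm P m t)"

fun subst :: "(nat \<Rightarrow> 'f trm) \<Rightarrow> 'f trm \<Rightarrow> 'f trm" where
  "subst \<sigma> (Var i) = \<sigma> i"
| "subst \<sigma> (Op f ts) = Op f (map (subst \<sigma>) ts)"

text \<open>Provable equality of terms in the variables \<open>Var 0, \<dots>, Var (m - 1)\<close>.\<close>

inductive prov :: "'f presentation \<Rightarrow> nat \<Rightarrow> 'f trm \<Rightarrow> 'f trm \<Rightarrow> bool"
  for P :: "'f presentation" and m :: nat where
  ax: "\<lbrakk>(s, t) \<in> axs P; wf_trm P m (subst \<sigma> s); wf_trm P m (subst \<sigma> t)\<rbrakk> \<Longrightarrow>
         prov P m (subst \<sigma> s) (subst \<sigma> t)"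
| refl: "wf_trm P m t \<Longrightarrow> prov P m t t"
| sym: "prov P m s t \<Longrightarrow> prov P m t s"
| trans: "\<lbrakk>prov P m s t; prov P m t u\<rbrakk> \<Longrightarrow> prov P m s u"
| cong: "\<lbrakk>f \<in> ops P; length ss = arity P f; list_all2 (prov P m) ss ts\<rbrakk> \<Longrightarrow>
         prov P m (Op f ss) (Op f ts)"

definition cls :: "'f presentation \<Rightarrow> nat \<Rightarrow> 'f trm \<Rightarrow> 'f trm set" where
  "cls P m t = {u. prov P m t u}"

text \<open>
  An arrow \<open>m \<rightarrow> n\<close> is an \<open>n\<close>-tuple of elements of the free model on \<open>m\<close> generators, i.e. of
  classes of terms in \<open>m\<close> variables; composition is substitution. The composite is written
  as the set of all terms provably equal to some substitution instance of representatives,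
  which avoids choosing representatives (see \<open>subst_cls_cls\<close>).
\<close>

definition subst_cls ::
    "'f presentation \<Rightarrow> nat \<Rightarrow> nat \<Rightarrow> 'f trm set list \<Rightarrow> 'f trm set \<Rightarrow> 'f trm set" where
  "subst_cls P l m gs c =
     {u. \<exists>t \<in> c. \<exists>\<sigma>. (\<forall>i<m. \<sigma> i \<in> gs ! i) \<and> prov P l (subst \<sigma> t) u}"

definition theory_of :: "'f presentation \<Rightarrow> 'f trm set list lawvere" where
  "theory_of P =
     \<lparr>arr = (\<lambda>m n. {cs. length cs = n \<and> set cs \<subseteq> {cls P m t | t. wf_trm P m t}}),
      ident = (\<lambda>n. map (\<lambda>i. cls P n (Var i)) [0..<n]),
      cmp = (\<lambda>l m n cs gs. map (subst_cls P l m gs) cs),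
      proj = (\<lambda>n i. [cls P n (Var i)])\<rparr>"


subsection \<open>It is a Lawvere theory\<close>

lemma subst_subst: "subst \<sigma> (subst \<tau> t) = subst (\<lambda>i. subst \<sigma> (\<tau> i)) t"
  by (induction t) auto

lemma prov_wf: "prov P m s t \<Longrightarrow> wf_trm P m s \<and> wf_trm P m t"
proof (induction rule: prov.induct)
  case (cong f ss ts)
  then show ?case
    by (auto simp: list_all2_conv_all_nth in_set_conv_nth)
qed auto

lemma wf_subst: "\<lbrakk>wf_trm P m t; \<And>i. i < m \<Longrightarrow> wf_trm P l (\<sigma> i)\<rbrakk> \<Longrightarrow> wf_trm P l (subst \<sigma> t)"
  by (induction t) auto

lemma prov_subst_cong:
  "\<lbrakk>wf_trm P m t; \<And>i. i < m \<Longrightarrow> prov P l (\<sigma> i) (\<tau> i)\<rbrakk> \<Longrightarrow> prov P l (subst \<sigma> t) (subst \<tau> t)"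
proof (induction t)
  case (Op f ts)
  then have "list_all2 (prov P l) (map (subst \<sigma>) ts) (map (subst \<tau>) ts)"
    by (auto simp: list_all2_conv_all_nth)
  with Op show ?case by (auto intro!: prov.cong)
qed auto

lemma prov_subst:
  assumes "prov P m s t" and \<sigma>: "\<And>i. i < m \<Longrightarrow> wf_trm P l (\<sigma> i)"
  shows "prov P l (subst \<sigma> s) (subst \<sigma> t)"
  using assms(1)
proof (induction rule: prov.induct)
  case (ax s t \<tau>)
  then have "wf_trm P l (subst \<sigma> (subst \<tau> s))" "wf_trm P l (subst \<sigma> (subst \<tau> t))"
    using \<sigma> by (auto intro: wf_subst)
  then show ?case using ax(1) unfolding subst_subst by (rule prov.ax[rotated])
next
  case (refl t)
  then show ?case by (intro prov.refl wf_subst[where m=m]) (auto simp: \<sigma>)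
next
  case (cong f ss ts)
  then have "list_all2 (prov P l) (map (subst \<sigma>) ss) (map (subst \<sigma>) ts)"
    by (auto simp: list_all2_conv_all_nth)
  with cong show ?case by (auto intro!: prov.cong)
qed (blast intro: prov.sym prov.trans)+

lemma cls_eq_iff: "wf_trm P m s \<Longrightarrow> cls P m s = cls P m t \<longleftrightarrow> prov P m s t"
  unfolding cls_def by (blast intro: prov.intros)

lemma subst_cls_cls:
  assumes t: "wf_trm P m t" and \<sigma>: "\<And>i. i < m \<Longrightarrow> wf_trm P l (\<sigma> i)"
    and gs: "\<And>i. i < m \<Longrightarrow> gs ! i = cls P l (\<sigma> i)"
  shows "subst_cls P l m gs (cls P m t) = cls P l (subst \<sigma> t)"
proof (intro set_eqI iffI)
  fix u assume "u \<in> subst_cls P l m gs (cls P m t)"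
  then obtain s \<tau> where st: "prov P m t s" and \<tau>: "\<And>i. i < m \<Longrightarrow> prov P l (\<sigma> i) (\<tau> i)"
    and u: "prov P l (subst \<tau> s) u"
    using gs unfolding subst_cls_def cls_def by auto
  have "prov P l (subst \<sigma> t) (subst \<tau> t)" by (rule prov_subst_cong[OF t \<tau>])
  moreover have "prov P l (subst \<tau> t) (subst \<tau> s)"
    using prov_subst[OF st] \<tau> prov_wf by blast
  ultimately show "u \<in> cls P l (subst \<sigma> t)"
    using u unfolding cls_def by (blast intro: prov.trans)
next
  fix u assume "u \<in> cls P l (subst \<sigma> t)"
  then show "u \<in> subst_cls P l m gs (cls P m t)"
    using t \<sigma> gs unfolding subst_cls_def cls_def by (auto intro: prov.refl)
qed

lemma arr_theory_of:
  "cs \<in> arr (theory_of P) m n \<longleftrightarrow>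
     (\<exists>\<sigma>. (\<forall>i<n. wf_trm P m (\<sigma> i)) \<and> cs = map (\<lambda>i. cls P m (\<sigma> i)) [0..<n])"
proof
  assume "cs \<in> arr (theory_of P) m n"
  then have len: "length cs = n" and "\<forall>i<n. \<exists>t. wf_trm P m t \<and> cs ! i = cls P m t"
    unfolding theory_of_def by (auto dest!: nth_mem)
  then obtain \<sigma> where "\<forall>i<n. wf_trm P m (\<sigma> i) \<and> cs ! i = cls P m (\<sigma> i)" by metis
  with len show "\<exists>\<sigma>. (\<forall>i<n. wf_trm P m (\<sigma> i)) \<and> cs = map (\<lambda>i. cls P m (\<sigma> i)) [0..<n]"
    by (intro exI[of _ \<sigma>]) (auto intro: nth_equalityI)
qed (auto simp: theory_of_def image_iff subset_iff, blast)

lemma comp_theory_of: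
  assumes "\<forall>i<n. wf_trm P m (\<tau> i)" "\<forall>i<m. wf_trm P l (\<sigma> i)"
  shows "cmp (theory_of P) l m n (map (\<lambda>i. cls P m (\<tau> i)) [0..<n])
      (map (\<lambda>i. cls P l (\<sigma> i)) [0..<m]) = map (\<lambda>i. cls P l (subst \<sigma> (\<tau> i))) [0..<n]"
  using assms by (simp add: theory_of_def subst_cls_cls)

lemma subst_Var: "subst Var t = t"
  by (induction t) (auto intro: map_idI)

lemma lawvere_theory_theory_of: "lawvere_theory (theory_of P)"
proof
  have idn: "ident (theory_of P) n = map (\<lambda>i. cls P n (Var i)) [0..<n]" for n
    by (simp add: theory_of_def)
  have prj: "proj (theory_of P) n i = map (\<lambda>j. cls P n (Var i)) [0..<1]" for n i
    by (simp add: theory_of_def)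
  show "ident (theory_of P) n \<in> arr (theory_of P) n n" for n
    unfolding arr_theory_of idn by (rule exI[of _ Var]) auto
  show "cmp (theory_of P) l m n f g \<in> arr (theory_of P) l n"
    if "f \<in> arr (theory_of P) m n" "g \<in> arr (theory_of P) l m" for f g l m n
  proof -
    from that obtain \<tau> \<sigma> where *: "\<forall>i<n. wf_trm P m (\<tau> i)" "\<forall>i<m. wf_trm P l (\<sigma> i)"
      and "f = map (\<lambda>i. cls P m (\<tau> i)) [0..<n]" "g = map (\<lambda>i. cls P l (\<sigma> i)) [0..<m]"
      unfolding arr_theory_of by blast
    then show ?thesis unfolding arr_theory_of
      by (intro exI[of _ "\<lambda>i. subst \<sigma> (\<tau> i)"]) (use comp_theory_of[OF *] in \<open>auto intro: wf_subst\<close>)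
  qed
  show "cmp (theory_of P) m n n (ident (theory_of P) n) f = f"
    if f: "f \<in> arr (theory_of P) m n" for f m n
  proof -
    from f obtain \<sigma> where s: "\<forall>i<n. wf_trm P m (\<sigma> i)" and f: "f = map (\<lambda>i. cls P m (\<sigma> i)) [0..<n]"
      unfolding arr_theory_of by blast
    show ?thesis unfolding idn f by (subst comp_theory_of) (use s in auto)
  qed
  show "cmp (theory_of P) m m n f (ident (theory_of P) m) = f"
    if f: "f \<in> arr (theory_of P) m n" for f m n
  proof -
    from f obtain \<sigma> where s: "\<forall>i<n. wf_trm P m (\<sigma> i)" and f: "f = map (\<lambda>i. cls P m (\<sigma> i)) [0..<n]"
      unfolding arr_theory_of by blast
    show ?thesis unfolding idn f by (subst comp_theory_of) (use s in \<open>auto simp: subst_Var\<close>)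
  qed
  show "cmp (theory_of P) k l n (cmp (theory_of P) l m n f g) h =
      cmp (theory_of P) k m n f (cmp (theory_of P) k l m g h)"
    if "f \<in> arr (theory_of P) m n" "g \<in> arr (theory_of P) l m" "h \<in> arr (theory_of P) k l"
    for f g h k l m n
  proof -
    from that obtain \<rho> \<tau> \<sigma>
      where *: "\<forall>i<n. wf_trm P m (\<rho> i)" "\<forall>i<m. wf_trm P l (\<tau> i)" "\<forall>i<l. wf_trm P k (\<sigma> i)"
      and e: "f = map (\<lambda>i. cls P m (\<rho> i)) [0..<n]" "g = map (\<lambda>i. cls P l (\<tau> i)) [0..<m]"
        "h = map (\<lambda>i. cls P k (\<sigma> i)) [0..<l]"
      unfolding arr_theory_of by blast
    have "\<forall>i<n. wf_trm P l (subst \<tau> (\<rho> i))" "\<forall>i<m. wf_trm P k (subst \<sigma> (\<tau> i))"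
      using * by (auto intro: wf_subst)
    then show ?thesis unfolding e using * by (simp add: comp_theory_of subst_subst)
  qed
  show "proj (theory_of P) n i \<in> arr (theory_of P) n 1" if "i < n" for i n
    unfolding arr_theory_of prj using that by (intro exI[of _ "\<lambda>_. Var i"]) auto
  show "proj (theory_of P) 1 0 = ident (theory_of P) 1"
    by (simp add: theory_of_def)
  show "\<exists>!g. g \<in> arr (theory_of P) m n \<and>
      (\<forall>i<n. cmp (theory_of P) m n 1 (proj (theory_of P) n i) g = fs i)"
    if fs: "\<And>i. i < n \<Longrightarrow> fs i \<in> arr (theory_of P) m 1" for n m fs
  proof -
    have prj_comp: "cmp (theory_of P) m n 1 (proj (theory_of P) n i) g = [g ! i]"
      if "g \<in> arr (theory_of P) m n" "i < n" for g i
    proof -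
      from that obtain \<sigma> where s: "\<forall>i<n. wf_trm P m (\<sigma> i)"
        and g: "g = map (\<lambda>i. cls P m (\<sigma> i)) [0..<n]"
        unfolding arr_theory_of by blast
      show ?thesis unfolding prj g by (subst comp_theory_of) (use s that in auto)
    qed
    have len: "length g = n" if "g \<in> arr (theory_of P) m n" for g
      using that unfolding arr_theory_of by auto
    have one: "\<exists>t. wf_trm P m t \<and> fs i = [cls P m t]" if "i < n" for i
      using fs[OF that] unfolding arr_theory_of by auto
    then obtain \<sigma> where s: "\<And>i. i < n \<Longrightarrow> wf_trm P m (\<sigma> i) \<and> fs i = [cls P m (\<sigma> i)]"
      by metis
    let ?g = "map (\<lambda>i. cls P m (\<sigma> i)) [0..<n]"
    have g: "?g \<in> arr (theory_of P) m n" unfolding arr_theory_of using s by blast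
    show ?thesis
    proof (rule ex1I[of _ ?g])
      show "?g \<in> arr (theory_of P) m n \<and>
          (\<forall>i<n. cmp (theory_of P) m n 1 (proj (theory_of P) n i) ?g = fs i)"
        using g s by (auto simp: prj_comp[OF g] simp del: One_nat_def)
    next
      fix h assume h: "h \<in> arr (theory_of P) m n \<and>
          (\<forall>i<n. cmp (theory_of P) m n 1 (proj (theory_of P) n i) h = fs i)"
      have "h ! i = cls P m (\<sigma> i)" if "i < n" for i
        using h s[OF that] prj_comp[of h i] that by simp
      then show "h = ?g"
        using h by (intro nth_equalityI) (simp_all add: len)
    qed
  qed
qed


section \<open>Quandles and sets\<close>

locale rack =
  fixes R :: "'a set" and tri :: "'a \<Rightarrow> 'a \<Rightarrow> 'a"  (infixr "\<rhd>" 70)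
  assumes bij: "x \<in> R \<Longrightarrow> bij_betw (\<lambda>y. x \<rhd> y) R R"
    and distrib: "\<lbrakk>x \<in> R; y \<in> R; z \<in> R\<rbrakk> \<Longrightarrow> x \<rhd> (y \<rhd> z) = (x \<rhd> y) \<rhd> (x \<rhd> z)"

locale quandle = rack +
  assumes idem: "x \<in> R \<Longrightarrow> x \<rhd> x = x"

text \<open>
  As an equational theory, quandles need besides \<open>\<rhd>\<close> (symbol \<open>Act\<close>) also the operation
  \<open>Inv\<close> with \<open>Inv(x, y)\<close> the preimage of \<open>y\<close> under left multiplication by \<open>x\<close>. It is determined
  by \<open>\<rhd>\<close> and preserved by all maps preserving \<open>\<rhd>\<close>, see \<open>quandle_iff_model\<close>,
  \<open>quandle_inverse_unique\<close> and \<open>quandle_morphism_inverse\<close>.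
\<close>

datatype quandle_op = Act | Inv

definition quandle_presentation :: "quandle_op presentation" where
  "quandle_presentation =
     (let x = Var 0; y = Var 1; z = Var 2;
          a = (\<lambda>s t. Op Act [s, t]); b = (\<lambda>s t. Op Inv [s, t])
      in \<lparr>ops = UNIV, arity = (\<lambda>_. 2),
          axs = {(a x (b x y), y),
                 (b x (a x y), y),
                 (a x (a y z), a (a x y) (a x z)),
                 (a x x, x)}\<rparr>)"

definition set_presentation :: "unit presentation" where
  "set_presentation = \<lparr>ops = {}, arity = (\<lambda>_. 0), axs = {}\<rparr>"

definition Quan :: "quandle_op trm set list lawvere" where
  "Quan = theory_of quandle_presentation"

definition Sets :: "unit trm set list lawvere" where
  "Sets = theory_of set_presentation"


subsection \<open>The models of the presentations\<close>

fun interp :: "('f \<Rightarrow> 'a list \<Rightarrow> 'a) \<Rightarrow> (nat \<Rightarrow> 'a) \<Rightarrow> 'f trm \<Rightarrow> 'a" where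
  "interp I \<rho> (Var i) = \<rho> i"
| "interp I \<rho> (Op f ts) = I f (map (interp I \<rho>) ts)"

definition model :: "'f presentation \<Rightarrow> 'a set \<Rightarrow> ('f \<Rightarrow> 'a list \<Rightarrow> 'a) \<Rightarrow> bool" where
  "model P A I \<longleftrightarrow>
     (\<forall>f \<in> ops P. \<forall>xs. length xs = arity P f \<and> set xs \<subseteq> A \<longrightarrow> I f xs \<in> A) \<and>
     (\<forall>(s, t) \<in> axs P. \<forall>\<rho>. range \<rho> \<subseteq> A \<longrightarrow> interp I \<rho> s = interp I \<rho> t)"

lemma model_set_presentation: "model set_presentation A I"
  by (simp add: model_def set_presentation_def)

lemma model_quandle_presentation:
  fixes A :: "'a set"
  shows "model quandle_presentation A I \<longleftrightarrow>
     (\<forall>x\<in>A. \<forall>y\<in>A. I Act [x, y] \<in> A \<and> I Inv [x, y] \<in> A \<and>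
        I Act [x, I Inv [x, y]] = y \<and> I Inv [x, I Act [x, y]] = y) \<and>
     (\<forall>x\<in>A. \<forall>y\<in>A. \<forall>z\<in>A.
        I Act [x, I Act [y, z]] = I Act [I Act [x, y], I Act [x, z]]) \<and>
     (\<forall>x\<in>A. I Act [x, x] = x)"
  (is "?L \<longleftrightarrow> ?R")
proof
  assume L: ?L
  then have c: "\<forall>f xs. length xs = 2 \<and> set xs \<subseteq> A \<longrightarrow> I f xs \<in> A"
    and e: "\<And>\<rho> :: nat \<Rightarrow> 'a. range \<rho> \<subseteq> A \<Longrightarrow>
      I Act [\<rho> 0, I Inv [\<rho> 0, \<rho> 1]] = \<rho> 1 \<and> I Inv [\<rho> 0, I Act [\<rho> 0, \<rho> 1]] = \<rho> 1 \<and>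
      I Act [\<rho> 0, I Act [\<rho> 1, \<rho> 2]] = I Act [I Act [\<rho> 0, \<rho> 1], I Act [\<rho> 0, \<rho> 2]] \<and>
      I Act [\<rho> 0, \<rho> 0] = \<rho> 0"
    unfolding model_def quandle_presentation_def Let_def by auto
  have cl: "I f [x, y] \<in> A" if "x \<in> A" "y \<in> A" for f x y
    using c that by simp
  have eq: "I Act [x, I Inv [x, y]] = y \<and> I Inv [x, I Act [x, y]] = y \<and>
      I Act [x, I Act [y, z]] = I Act [I Act [x, y], I Act [x, z]] \<and> I Act [x, x] = x"
    if "x \<in> A" "y \<in> A" "z \<in> A" for x y z
    using e[of "\<lambda>i. if i = 0 then x else if i = 1 then y else z"] that by (auto split: if_splits)
  show ?R using cl eq by blast
next
  assume R: ?R
  have cl: "I f xs \<in> A" if "length xs = 2" "set xs \<subseteq> A" for f xs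
  proof -
    from that obtain x y where xs: "xs = [x, y]" "x \<in> A" "y \<in> A"
      by (auto simp: numeral_2_eq_2 length_Suc_conv)
    then have "I Act [x, y] \<in> A \<and> I Inv [x, y] \<in> A" using R by blast
    with xs show ?thesis by (cases f) simp_all
  qed
  have "interp I \<rho> s = interp I \<rho> t"
    if st: "(s, t) \<in> axs quandle_presentation" and "range \<rho> \<subseteq> A" for s t and \<rho> :: "nat \<Rightarrow> 'a"
  proof -
    from that have \<rho>: "\<rho> i \<in> A" for i by auto
    have "I Act [\<rho> 0, I Inv [\<rho> 0, \<rho> 1]] = \<rho> 1" "I Inv [\<rho> 0, I Act [\<rho> 0, \<rho> 1]] = \<rho> 1"
      "I Act [\<rho> 0, I Act [\<rho> 1, \<rho> 2]] = I Act [I Act [\<rho> 0, \<rho> 1], I Act [\<rho> 0, \<rho> 2]]"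
      "I Act [\<rho> 0, \<rho> 0] = \<rho> 0"
      using R \<rho> by blast+
    with st show ?thesis
      unfolding quandle_presentation_def Let_def by auto
  qed
  moreover have "arity quandle_presentation f = 2" for f
    by (simp add: quandle_presentation_def Let_def)
  ultimately show ?L
    using cl unfolding model_def by auto
qed

lemma quandle_iff_model:
  "quandle R tri \<longleftrightarrow>
     (\<exists>I. model quandle_presentation R I \<and> (\<forall>x\<in>R. \<forall>y\<in>R. I Act [x, y] = tri x y))"
proof
  assume "quandle R tri"
  then interpret quandle R tri .
  let ?I = "\<lambda>f xs. case f of Act \<Rightarrow> tri (xs ! 0) (xs ! 1)
                            | Inv \<Rightarrow> inv_into R (tri (xs ! 0)) (xs ! 1)"
  have b: "bij_betw (tri x) R R" if "x \<in> R" for x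
    using bij[OF that] by simp
  have "model quandle_presentation R ?I"
    unfolding model_quandle_presentation
  proof (intro conjI ballI)
    fix x y z assume "x \<in> R" "y \<in> R" "z \<in> R"
    then show "?I Act [x, ?I Act [y, z]] = ?I Act [?I Act [x, y], ?I Act [x, z]]"
      using distrib[of x y z] by simp
  qed (use idem bij_betwE[OF b] bij_betwE[OF bij_betw_inv_into[OF b]]
      bij_betw_inv_into_left[OF b] bij_betw_inv_into_right[OF b] in simp_all)
  then show "\<exists>I. model quandle_presentation R I \<and> (\<forall>x\<in>R. \<forall>y\<in>R. I Act [x, y] = tri x y)"
    by (intro exI[of _ ?I]) simp
next
  assume "\<exists>I. model quandle_presentation R I \<and> (\<forall>x\<in>R. \<forall>y\<in>R. I Act [x, y] = tri x y)"
  then obtain I where I: "model quandle_presentation R I"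
    and t: "\<And>x y. x \<in> R \<Longrightarrow> y \<in> R \<Longrightarrow> I Act [x, y] = tri x y" by blast
  note m = I[unfolded model_quandle_presentation]
  have cl: "tri x y \<in> R" and inv: "I Inv [x, y] \<in> R"
    and inv1: "tri x (I Inv [x, y]) = y" and inv2: "I Inv [x, tri x y] = y"
    if "x \<in> R" "y \<in> R" for x y
    using m that by (metis t)+
  show "quandle R tri"
  proof
    show "bij_betw (\<lambda>y. tri x y) R R" if x: "x \<in> R" for x
      by (rule bij_betw_byWitness[where f' = "\<lambda>y. I Inv [x, y]"])
        (use x cl inv inv1 inv2 in auto)
    show "tri x (tri y z) = tri (tri x y) (tri x z)" if xyz: "x \<in> R" "y \<in> R" "z \<in> R" for x y z
    proof -
      have "I Act [x, I Act [y, z]] = I Act [I Act [x, y], I Act [x, z]]"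
        using m xyz by blast
      then show ?thesis
        unfolding t[OF xyz(1,2)] t[OF xyz(1,3)] t[OF xyz(2,3)]
        using t[OF xyz(1) cl[OF xyz(2,3)]] t[OF cl[OF xyz(1,2)] cl[OF xyz(1,3)]] by metis
    qed
    show "tri x x = x" if "x \<in> R" for x
      using m that t by metis
  qed
qed

lemma quandle_inverse_unique:
  assumes "model quandle_presentation R I" "model quandle_presentation R J"
    and "\<forall>x\<in>R. \<forall>y\<in>R. I Act [x, y] = J Act [x, y]" and "x \<in> R" "y \<in> R"
  shows "I Inv [x, y] = J Inv [x, y]"
  using assms unfolding model_quandle_presentation by metis

lemma quandle_morphism_inverse:
  assumes "model quandle_presentation R I" "model quandle_presentation S J"
    and "h ` R \<subseteq> S" "\<forall>x\<in>R. \<forall>y\<in>R. h (I Act [x, y]) = J Act [h x, h y]"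
    and "x \<in> R" "y \<in> R"
  shows "h (I Inv [x, y]) = J Inv [h x, h y]"
proof -
  note m = assms(1,2)[unfolded model_quandle_presentation]
  have i: "I Inv [x, y] \<in> R" "I Act [x, I Inv [x, y]] = y" using m(1) assms(5,6) by auto
  have "J Act [h x, h (I Inv [x, y])] = h y" using assms(4,5) i by metis
  moreover have "h x \<in> S" "h (I Inv [x, y]) \<in> S" using assms(3,5) i by auto
  ultimately show ?thesis using m(2) by metis
qed

end

theory Submission
  imports Defs
begin

text \<open>
  Interpreting every operation symbol of one presentation by a term of another, compatibly with
  the axioms, induces a morphism of theories. Sets have no operations, so they interpret
  trivially in quandles. Conversely \<open>x \<rhd> y = y\<close> makes every set a quandle, so both quandle
  operations can be interpreted by the second projection. The composite fixes all variables,
  which are the only terms in the theory of sets.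
\<close>

lemma subst_cong: "\<lbrakk>wf_trm P m t; \<And>i. i < m \<Longrightarrow> \<sigma> i = \<tau> i\<rbrakk> \<Longrightarrow> subst \<sigma> t = subst \<tau> t"
  by (induction t) auto

text \<open>The term \<open>\<phi> f\<close> has its variables below the arity of \<open>f\<close>; \<open>Var i\<close> is the \<open>i\<close>-th argument.\<close>

fun translate :: "('f \<Rightarrow> 'g trm) \<Rightarrow> 'f trm \<Rightarrow> 'g trm" where
  "translate \<phi> (Var i) = Var i"
| "translate \<phi> (Op f ts) = subst ((!) (map (translate \<phi>) ts)) (\<phi> f)"

text \<open>As in \<open>subst_cls\<close>, saturating under provable equality avoids choosing a
  representative of \<open>c\<close>.\<close>

definition translate_cls ::
    "('f \<Rightarrow> 'g trm) \<Rightarrow> 'g presentation \<Rightarrow> nat \<Rightarrow> 'f trm set \<Rightarrow> 'g trm set" where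
  "translate_cls \<phi> Q m c = {u. \<exists>t \<in> c. prov Q m (translate \<phi> t) u}"

text \<open>The condition on axioms mirrors the rule \<open>prov.ax\<close>: it covers every
  well-formed instance, because \<open>axs\<close> fixes no bound on the variables of an
  axiom.\<close>

locale interpretation_of_presentations =
  fixes P :: "'f presentation" and Q :: "'g presentation" and \<phi> :: "'f \<Rightarrow> 'g trm"
  assumes wf_symbol: "f \<in> ops P \<Longrightarrow> wf_trm Q (arity P f) (\<phi> f)"
    and axiom: "\<lbrakk>(s, t) \<in> axs P; wf_trm Q m (subst \<sigma> (translate \<phi> s));
          wf_trm Q m (subst \<sigma> (translate \<phi> t))\<rbrakk> \<Longrightarrow>
        prov Q m (subst \<sigma> (translate \<phi> s)) (subst \<sigma> (translate \<phi> t))"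
begin

lemma wf_translate: "wf_trm P m t \<Longrightarrow> wf_trm Q m (translate \<phi> t)"
  by (induction t) (auto intro!: wf_subst wf_symbol)

text \<open>Well-formedness keeps the variables of \<open>\<phi> f\<close> below the number of
  arguments; past the end of a list, \<open>!\<close> is unspecified and need not commute with
  \<open>map\<close>.\<close>

lemma translate_subst:
  "wf_trm P m (subst \<sigma> t) \<Longrightarrow>
     translate \<phi> (subst \<sigma> t) = subst (\<lambda>i. translate \<phi> (\<sigma> i)) (translate \<phi> t)"
proof (induction t)
  case (Op f ts)
  then show ?case
    by (auto simp: subst_subst intro!: subst_cong[OF wf_symbol])
qed simp

text \<open>Instances of axioms translate to instances of translated axioms. An operation translates
  to a substitution into \<open>\<phi> f\<close>, so congruence becomes
  \<open>prov_subst_cong\<close>.\<close>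

lemma prov_translate: "prov P m s t \<Longrightarrow> prov Q m (translate \<phi> s) (translate \<phi> t)"
proof (induction rule: prov.induct)
  case (ax s t \<sigma>)
  from ax(2,3)[THEN wf_translate] show ?case
    unfolding translate_subst[OF ax(2)] translate_subst[OF ax(3)] by (rule axiom[OF ax(1)])
next
  case (refl t)
  then show ?case by (intro prov.refl wf_translate)
next
  case (cong f ss ts)
  then show ?case
    by (auto simp: list_all2_conv_all_nth intro!: prov_subst_cong[OF wf_symbol])
qed (blast intro: prov.sym prov.trans)+

lemma translate_cls_cls:
  assumes "wf_trm P m t"
  shows "translate_cls \<phi> Q m (cls P m t) = cls Q m (translate \<phi> t)"
  unfolding translate_cls_def cls_def
  using prov.refl[OF assms] by (blast intro: prov.trans prov_translate)

text \<open>The functor acts on each component of a tuple of classes. Identities and projections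
  consist of variables, which translation fixes; composites are handled by
  \<open>translate_subst\<close>.\<close>

lemma lawvere_morphism_translate:
  "lawvere_morphism (theory_of P) (theory_of Q) (\<lambda>m n. map (translate_cls \<phi> Q m))"
proof (intro lawvere_morphism.intro lawvere_theory_theory_of lawvere_morphism_axioms.intro)
  fix f m n assume "f \<in> arr (theory_of P) m n"
  then obtain \<sigma> where "\<forall>i<n. wf_trm P m (\<sigma> i)" "f = map (\<lambda>i. cls P m (\<sigma> i)) [0..<n]"
    unfolding arr_theory_of by blast
  then show "map (translate_cls \<phi> Q m) f \<in> arr (theory_of Q) m n"
    unfolding arr_theory_of
    by (intro exI[of _ "\<lambda>i. translate \<phi> (\<sigma> i)"]) (auto simp: translate_cls_cls wf_translate)
next
  fix n
  show "map (translate_cls \<phi> Q n) (ident (theory_of P) n) = ident (theory_of Q) n"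
    by (auto simp: theory_of_def translate_cls_cls)
next
  fix f g l m n assume "f \<in> arr (theory_of P) m n" "g \<in> arr (theory_of P) l m"
  then obtain \<tau> \<sigma> where wf: "\<forall>i<n. wf_trm P m (\<tau> i)" "\<forall>i<m. wf_trm P l (\<sigma> i)"
    and eqs: "f = map (\<lambda>i. cls P m (\<tau> i)) [0..<n]" "g = map (\<lambda>i. cls P l (\<sigma> i)) [0..<m]"
    unfolding arr_theory_of by blast
  have wf_comp: "wf_trm P l (subst \<sigma> (\<tau> i))" if "i < n" for i
    using wf that by (auto intro: wf_subst)
  have maps: "map (translate_cls \<phi> Q m) f = map (\<lambda>i. cls Q m (translate \<phi> (\<tau> i))) [0..<n]"
    "map (translate_cls \<phi> Q l) g = map (\<lambda>i. cls Q l (translate \<phi> (\<sigma> i))) [0..<m]"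
    using wf by (auto simp: eqs translate_cls_cls)
  have "map (translate_cls \<phi> Q l) (cmp (theory_of P) l m n f g) =
      map (\<lambda>i. cls Q l (translate \<phi> (subst \<sigma> (\<tau> i)))) [0..<n]"
    unfolding eqs comp_theory_of[OF wf] by (auto simp: translate_cls_cls wf_comp)
  also have "\<dots> = cmp (theory_of Q) l m n
      (map (translate_cls \<phi> Q m) f) (map (translate_cls \<phi> Q l) g)"
    unfolding maps using wf
    by (subst comp_theory_of) (auto simp: wf_translate translate_subst[OF wf_comp])
  finally show "map (translate_cls \<phi> Q l) (cmp (theory_of P) l m n f g) =
      cmp (theory_of Q) l m n (map (translate_cls \<phi> Q m) f) (map (translate_cls \<phi> Q l) g)" .
next
  fix i n :: nat assume "i < n"
  then show "map (translate_cls \<phi> Q n) (proj (theory_of P) n i) = proj (theory_of Q) n i"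
    by (simp add: theory_of_def translate_cls_cls)
qed

end

lemma interpretation_of_sets: "interpretation_of_presentations set_presentation Q \<phi>"
  by unfold_locales (simp_all add: set_presentation_def)

text \<open>Arguments are counted from 0, so \<open>Var 1\<close> is the second one. Both sides of
  each quandle axiom collapse to the same variable, leaving only reflexivity.\<close>

lemma interpretation_trivial_quandle:
  "interpretation_of_presentations quandle_presentation Q (\<lambda>_. Var 1)"
  by unfold_locales (auto simp: quandle_presentation_def Let_def intro: prov.refl)

lemma wf_set_presentation: "wf_trm set_presentation m t \<longleftrightarrow> (\<exists>i<m. t = Var i)"
  by (cases t) (auto simp: set_presentation_def)

theorem proposition3p2:
  shows "\<exists>F G. lawvere_morphism Sets Quan F \<and> lawvere_morphism Quan Sets G \<and>
           (\<forall>m n. \<forall>f \<in> arr Sets m n. G m n (F m n f) = f)"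
proof -
  \<comment> \<open>\<open>Var 0\<close> is a dummy value: there is no symbol to interpret.\<close>
  interpret F: interpretation_of_presentations set_presentation quandle_presentation "\<lambda>_. Var 0"
    by (rule interpretation_of_sets)
  interpret G: interpretation_of_presentations quandle_presentation set_presentation "\<lambda>_. Var 1"
    by (rule interpretation_trivial_quandle)
  let ?F = "\<lambda>m (n :: nat). map (translate_cls (\<lambda>_. Var 0) quandle_presentation m)"
  let ?G = "\<lambda>m (n :: nat). map (translate_cls (\<lambda>_. Var 1) set_presentation m)"
  have "?G m n (?F m n f) = f" if "f \<in> arr Sets m n" for m n f
  proof -
    from that obtain \<sigma> where wf: "\<forall>i<n. wf_trm set_presentation m (\<sigma> i)"
      and f: "f = map (\<lambda>i. cls set_presentation m (\<sigma> i)) [0..<n]"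
      unfolding Sets_def arr_theory_of by blast
    have "translate_cls (\<lambda>_. Var 1) set_presentation m (translate_cls (\<lambda>_. Var 0)
        quandle_presentation m (cls set_presentation m (\<sigma> i))) = cls set_presentation m (\<sigma> i)"
      if "i < n" for i
    proof -
      from wf that obtain j where j: "\<sigma> i = Var j" "wf_trm set_presentation m (Var j)"
        unfolding wf_set_presentation by auto
      then show ?thesis
        using F.translate_cls_cls[OF j(2)] G.translate_cls_cls[of m "Var j"] by simp
    qed
    then show ?thesis by (simp add: f)
  qed
  then show ?thesis
    using F.lawvere_morphism_translate G.lawvere_morphism_translate
    unfolding Sets_def Quan_def by blast
qed

end
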